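(* Let $X$ be an Alexander quandle, given by an abelian group $X$ with an automorphism $t:X\to X$, such that $1-t:X\to X$ is invertible. Then there is an isomorphism $$H_2^Q(X;\mathbb{Z})\cong\frac{X\wedge_{\mathbb{Z}}X}{\{x\wedge y-tx\wedge ty\}_{x,y\in X}}.$$
   Context: An Alexander quandle is an abelian group $X$ with a group automorphism $t:X\to X$ and the binary operation $x*y=tx+(1-t)y$. For a quandle $X$, let $C_n^R(X)=\mathbb{Z}\langle X^n\rangle$ be the free abelian group on $X^n$, with $\partial_2^R(x,y)=(x)-(x*y)$ and $\partial_3^R(x,y,z)=(x,z)-(x*y,z)-(x,y)+(x*z,y*z)$. The second quandle homology $H_2^Q(X;\mathbb{Z})$ is the quotient of $\mathrm{Ker}(\partial_2^R)$ by the subgroup generated by $\mathrm{Im}(\partial_3^R)$ and all $(a,a)$ with $a\in X$. $X\wedge_{\mathbb{Z}}X$ is the exterior square of the abelian group $X$, i.e. $X\otimes_{\mathbb{Z}}X$ modulo the subgroup generated by all $x\otimes x$. A quotient by a set of elements means the quotient by the subgroup they generate. *)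

theory Defs
  imports "HOL-Algebra.Free_Abelian_Groups"
begin

section \<open>Quandles and their second homology\<close>

locale quandle =
  fixes Q :: "'a set" and star :: "'a \<Rightarrow> 'a \<Rightarrow> 'a"  (infixl \<open>\<triangleright>\<close> 70)
  assumes idem: "x \<in> Q \<Longrightarrow> x \<triangleright> x = x"
    and bij: "y \<in> Q \<Longrightarrow> bij_betw (\<lambda>x. x \<triangleright> y) Q Q"
    and distrib: "\<lbrakk>x \<in> Q; y \<in> Q; z \<in> Q\<rbrakk> \<Longrightarrow> (x \<triangleright> y) \<triangleright> z = (x \<triangleright> z) \<triangleright> (y \<triangleright> z)"

text \<open>
  The basis \<open>Q^n\<close> of the rack chain group in degree \<open>n\<close> is \<open>Q\<close>, \<open>Q \<times> Q\<close>, \<open>Q \<times> Q \<times> Q\<close>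
  for \<open>n = 1, 2, 3\<close>.
\<close>

definition rack_C1 :: "'a set \<Rightarrow> ('a \<Rightarrow>\<^sub>0 int) monoid" where
  "rack_C1 Q = free_Abelian_group Q"

definition rack_C2 :: "'a set \<Rightarrow> ('a \<times> 'a \<Rightarrow>\<^sub>0 int) monoid" where
  "rack_C2 Q = free_Abelian_group (Q \<times> Q)"

definition rack_C3 :: "'a set \<Rightarrow> ('a \<times> 'a \<times> 'a \<Rightarrow>\<^sub>0 int) monoid" where
  "rack_C3 Q = free_Abelian_group (Q \<times> Q \<times> Q)"

definition rack_d2 :: "('a \<Rightarrow> 'a \<Rightarrow> 'a) \<Rightarrow> ('a \<times> 'a \<Rightarrow>\<^sub>0 int) \<Rightarrow> ('a \<Rightarrow>\<^sub>0 int)" where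
  "rack_d2 star = frag_extend (\<lambda>(x, y). frag_of x - frag_of (star x y))"

definition rack_d3 ::
  "('a \<Rightarrow> 'a \<Rightarrow> 'a) \<Rightarrow> ('a \<times> 'a \<times> 'a \<Rightarrow>\<^sub>0 int) \<Rightarrow> ('a \<times> 'a \<Rightarrow>\<^sub>0 int)" where
  "rack_d3 star = frag_extend (\<lambda>(x, y, z).
     frag_of (x, z) - frag_of (star x y, z) - frag_of (x, y) + frag_of (star x z, star y z))"

definition rack_Z2 :: "'a set \<Rightarrow> ('a \<Rightarrow> 'a \<Rightarrow> 'a) \<Rightarrow> ('a \<times> 'a \<Rightarrow>\<^sub>0 int) monoid" where
  "rack_Z2 Q star =
     subgroup_generated (rack_C2 Q) (kernel (rack_C2 Q) (rack_C1 Q) (rack_d2 star))"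

definition quot_gen :: "('a, 'b) monoid_scheme \<Rightarrow> 'a set \<Rightarrow> 'a set monoid" where
  "quot_gen G R = G Mod generate G R"

definition quot_class :: "('a, 'b) monoid_scheme \<Rightarrow> 'a set \<Rightarrow> 'a \<Rightarrow> 'a set" where
  "quot_class G R x = generate G R #>\<^bsub>G\<^esub> x"

definition quandle_H2 ::
  "'a set \<Rightarrow> ('a \<Rightarrow> 'a \<Rightarrow> 'a) \<Rightarrow> ('a \<times> 'a \<Rightarrow>\<^sub>0 int) set monoid" where
  "quandle_H2 Q star =
     quot_gen (rack_Z2 Q star)
       (rack_d3 star ` carrier (rack_C3 Q) \<union> (\<lambda>a. frag_of (a, a)) ` Q)"


section \<open>Alexander quandles\<close>

text \<open>
  Abelian groups are written multiplicatively, as usual for HOL-Algebra: \<open>one_minus G t\<close> is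
  the endomorphism \<open>1 - t\<close>, and \<open>alexander_op G t x y\<close> is \<open>t x + (1 - t) y\<close>.
\<close>

definition one_minus :: "('a, 'b) monoid_scheme \<Rightarrow> ('a \<Rightarrow> 'a) \<Rightarrow> 'a \<Rightarrow> 'a" where
  "one_minus G t x = x \<otimes>\<^bsub>G\<^esub> inv\<^bsub>G\<^esub> (t x)"

definition alexander_op :: "('a, 'b) monoid_scheme \<Rightarrow> ('a \<Rightarrow> 'a) \<Rightarrow> 'a \<Rightarrow> 'a \<Rightarrow> 'a" where
  "alexander_op G t x y = t x \<otimes>\<^bsub>G\<^esub> one_minus G t y"


section \<open>The exterior square of an abelian group\<close>

definition tensor_rels :: "('a, 'b) monoid_scheme \<Rightarrow> ('a \<times> 'a \<Rightarrow>\<^sub>0 int) set" where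
  "tensor_rels G =
     {frag_of (x \<otimes>\<^bsub>G\<^esub> y, z) - frag_of (x, z) - frag_of (y, z) | x y z.
        x \<in> carrier G \<and> y \<in> carrier G \<and> z \<in> carrier G} \<union>
     {frag_of (x, y \<otimes>\<^bsub>G\<^esub> z) - frag_of (x, y) - frag_of (x, z) | x y z.
        x \<in> carrier G \<and> y \<in> carrier G \<and> z \<in> carrier G}"

definition tensor_square :: "('a, 'b) monoid_scheme \<Rightarrow> ('a \<times> 'a \<Rightarrow>\<^sub>0 int) set monoid" where
  "tensor_square G = quot_gen (free_Abelian_group (carrier G \<times> carrier G)) (tensor_rels G)"

definition tensor :: "('a, 'b) monoid_scheme \<Rightarrow> 'a \<Rightarrow> 'a \<Rightarrow> ('a \<times> 'a \<Rightarrow>\<^sub>0 int) set" where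
  "tensor G x y =
     quot_class (free_Abelian_group (carrier G \<times> carrier G)) (tensor_rels G) (frag_of (x, y))"

definition exterior_square ::
  "('a, 'b) monoid_scheme \<Rightarrow> ('a \<times> 'a \<Rightarrow>\<^sub>0 int) set set monoid" where
  "exterior_square G = quot_gen (tensor_square G) {tensor G x x | x. x \<in> carrier G}"

definition wedge :: "('a, 'b) monoid_scheme \<Rightarrow> 'a \<Rightarrow> 'a \<Rightarrow> ('a \<times> 'a \<Rightarrow>\<^sub>0 int) set set" where
  "wedge G x y = quot_class (tensor_square G) {tensor G x x | x. x \<in> carrier G} (tensor G x y)"

definition wedge_coinvariants ::
  "('a, 'b) monoid_scheme \<Rightarrow> ('a \<Rightarrow> 'a) \<Rightarrow> ('a \<times> 'a \<Rightarrow>\<^sub>0 int) set set set monoid" where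
  "wedge_coinvariants G t =
     quot_gen (exterior_square G)
       {wedge G x y \<otimes>\<^bsub>exterior_square G\<^esub> inv\<^bsub>exterior_square G\<^esub> (wedge G (t x) (t y)) | x y.
          x \<in> carrier G \<and> y \<in> carrier G}"


section \<open>Well-definedness\<close>

lemma (in comm_group) alexander_quandle:
  assumes "t \<in> iso G G"
  shows "quandle (carrier G) (alexander_op G t)"
proof -
  have t: "t \<in> hom G G" and b: "bij_betw t (carrier G) (carrier G)"
    using assms by (auto simp: iso_def)
  have tc [simp]: "t x \<in> carrier G" if "x \<in> carrier G" for x
    using t that by (auto simp: hom_def)
  have tm [simp]: "t (x \<otimes> y) = t x \<otimes> t y" if "x \<in> carrier G" "y \<in> carrier G" for x y
    using t that by (auto simp: hom_def)
  interpret t: group_hom G G t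
    by (unfold_locales) (rule t)
  have oc [simp]: "one_minus G t y \<in> carrier G" if "y \<in> carrier G" for y
    using that by (simp add: one_minus_def)
  show ?thesis
  proof
    fix x assume x: "x \<in> carrier G"
    have "t x \<otimes> (x \<otimes> inv t x) = x \<otimes> (t x \<otimes> inv t x)"
      using x by (simp add: m_lcomm)
    then show "alexander_op G t x x = x"
      using x by (simp add: alexander_op_def one_minus_def)
  next
    fix y assume y: "y \<in> carrier G"
    have "bij_betw (\<lambda>x. x \<otimes> one_minus G t y) (carrier G) (carrier G)"
    proof (rule bij_betwI[where g = "\<lambda>x. x \<otimes> inv (one_minus G t y)"])
    qed (use y in \<open>auto simp: m_assoc\<close>)
    from bij_betw_trans[OF b this]
    show "bij_betw (\<lambda>x. alexander_op G t x y) (carrier G) (carrier G)"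
      by (simp add: alexander_op_def o_def)
  next
    fix x y z assume c: "x \<in> carrier G" "y \<in> carrier G" "z \<in> carrier G"
    have cancel: "q \<otimes> (p \<otimes> (s \<otimes> (inv q \<otimes> (inv q \<otimes> (r \<otimes> inv s))))) = p \<otimes> (inv q \<otimes> r)"
      if "p \<in> carrier G" "q \<in> carrier G" "r \<in> carrier G" "s \<in> carrier G" for p q r s
    proof -
      have "q \<otimes> (p \<otimes> (s \<otimes> (inv q \<otimes> (inv q \<otimes> (r \<otimes> inv s))))) =
            (q \<otimes> inv q) \<otimes> ((s \<otimes> inv s) \<otimes> (p \<otimes> (inv q \<otimes> r)))"
        using that by (simp only: m_ac m_closed inv_closed)
      then show ?thesis
        using that by simp
    qed
    show "alexander_op G t (alexander_op G t x y) z =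
          alexander_op G t (alexander_op G t x z) (alexander_op G t y z)"
      using c by (simp add: alexander_op_def one_minus_def inv_mult m_ac cancel)
  qed
qed

context quandle
begin

lemma star_closed: "\<lbrakk>x \<in> Q; y \<in> Q\<rbrakk> \<Longrightarrow> x \<triangleright> y \<in> Q"
  using bij[of y] by (auto simp: bij_betw_def)

lemma rack_d2_d3:
  assumes "c \<in> carrier (rack_C3 Q)"
  shows "rack_d2 (\<triangleright>) (rack_d3 (\<triangleright>) c) = 0"
proof -
  have c: "Poly_Mapping.keys c \<subseteq> Q \<times> Q \<times> Q"
    using assms by (simp add: rack_C3_def)
  show ?thesis
    using c
  proof (induction c rule: frag_induction)
    case zero
    then show ?case by (simp add: rack_d2_def rack_d3_def)
  next
    case (one p)
    then show ?case
      by (cases p) (simp add: rack_d2_def rack_d3_def frag_extend_add frag_extend_diff distrib)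
  next
    case (diff a b)
    then show ?case by (simp add: rack_d2_def rack_d3_def frag_extend_diff)
  qed
qed

lemma rack_d3_closed:
  assumes "c \<in> carrier (rack_C3 Q)"
  shows "rack_d3 (\<triangleright>) c \<in> carrier (rack_C2 Q)"
proof -
  have c: "Poly_Mapping.keys c \<subseteq> Q \<times> Q \<times> Q"
    using assms by (simp add: rack_C3_def)
  have G: "a + b \<in> carrier (rack_C2 Q)" "a - b \<in> carrier (rack_C2 Q)"
    if "a \<in> carrier (rack_C2 Q)" "b \<in> carrier (rack_C2 Q)" for a b :: "'a \<times> 'a \<Rightarrow>\<^sub>0 int"
    using that keys_add[of a b] keys_diff[of a b]
    by (auto simp: rack_C2_def dest!: subsetD)
  have F: "frag_of (x, y) \<in> carrier (rack_C2 Q)" if "x \<in> Q" "y \<in> Q" for x y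
    using that by (simp add: rack_C2_def)
  show ?thesis
    using c
  proof (induction c rule: frag_induction)
    case zero
    then show ?case by (simp add: rack_d3_def rack_C2_def)
  next
    case (one p)
    then show ?case
      by (cases p) (simp add: rack_d3_def G F star_closed)
  next
    case (diff a b)
    then show ?case using G by (simp add: rack_d3_def frag_extend_diff)
  qed
qed

lemma quandle_H2_relators_are_cycles:
  "rack_d3 (\<triangleright>) ` carrier (rack_C3 Q) \<union> (\<lambda>a. frag_of (a, a)) ` Q \<subseteq> carrier (rack_Z2 Q (\<triangleright>))"
proof -
  let ?K = "kernel (rack_C2 Q) (rack_C1 Q) (rack_d2 (\<triangleright>))"
  have "rack_d3 (\<triangleright>) ` carrier (rack_C3 Q) \<subseteq> ?K"
    using rack_d2_d3 rack_d3_closed by (auto simp: kernel_def rack_C1_def)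
  moreover have "(\<lambda>a. frag_of (a, a)) ` Q \<subseteq> ?K"
    by (auto simp: kernel_def rack_C1_def rack_C2_def rack_d2_def idem)
  moreover have "?K \<subseteq> carrier (rack_Z2 Q (\<triangleright>))"
    by (auto simp: rack_Z2_def carrier_subgroup_generated kernel_def intro: generate.incl)
  ultimately show ?thesis by blast
qed

end

end

theory Submission
  imports Defs
begin

text \<open>
  Write \<open>s = 1 - t\<close>. The chain \<open>(0, s\<^sup>-\<^sup>1 x)\<close> has boundary \<open>(0) - (x)\<close>, so adding such chains to
  \<open>(x, y)\<close> gives a projection of the 2-chains onto the 2-cycles, and the second homology becomes the
  group generated by symbols \<open>e(x, y)\<close> subject to the quandle cocycle relation, \<open>e(x, x) = 0\<close> and
  \<open>e(0, y) = 0\<close>. Invertibility of \<open>s\<close> forces such an \<open>e\<close> to be bilinear and \<open>t\<close>-invariant: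
  \<open>f(u, v) = e(t\<^sup>-\<^sup>1 u, s\<^sup>-\<^sup>1 v)\<close> turns out to be a 2-cocycle of the abelian group with
  \<open>f(s u, v) = f(u, v) - f(v, u)\<close>, and the right-hand side is bilinear for every such
  2-cocycle. Conversely \<open>x \<and> y\<close> satisfies the relations of \<open>e(x, y)\<close> modulo
  \<open>x \<and> y = t x \<and> t y\<close>. Hence \<open>e(x, y) \<mapsto> x \<and> y\<close> is an isomorphism.
\<close>

section \<open>Computing modulo a subgroup of formal sums\<close>

text \<open>Congruences are stated as membership of a difference in \<open>V\<close>, so that both
  directions are computed with formal sums by \<open>algebra_simps\<close> instead of inside nested
  quotient groups. Later \<open>V\<close> is the subgroup of homology relators in one direction and
  the kernel of \<open>wedge_class\<close> in the other.\<close>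

locale difference_closed =
  fixes V :: "'h::ab_group_add set"
  assumes zero_mem: "0 \<in> V"
    and diff_mem: "\<lbrakk>a \<in> V; b \<in> V\<rbrakk> \<Longrightarrow> a - b \<in> V"
begin

lemma add_mem: "\<lbrakk>a \<in> V; b \<in> V\<rbrakk> \<Longrightarrow> a + b \<in> V"
  using diff_mem[of a "0 - b"] diff_mem[of 0 b] zero_mem by simp

lemma diff_mem_trans: "\<lbrakk>a - b \<in> V; b \<in> V\<rbrakk> \<Longrightarrow> a \<in> V"
  using add_mem[of "a - b" b] by simp

end

section \<open>Alexander quandles with 1 - t invertible\<close>

locale connected_alexander = comm_group A for A :: "('a, 'b) monoid_scheme" (structure) +
  fixes t :: "'a \<Rightarrow> 'a"
  assumes t_iso: "t \<in> iso A A"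
    and s_iso: "one_minus A t \<in> iso A A"
begin

abbreviation s where "s \<equiv> one_minus A t"
abbreviation op (infixl \<open>\<triangleright>\<close> 70) where "x \<triangleright> y \<equiv> alexander_op A t x y"

definition ti where "ti = inv_into (carrier A) t"
definition si where "si = inv_into (carrier A) s"

lemma t_hom: "t \<in> hom A A" and s_hom: "s \<in> hom A A"
  using t_iso s_iso by (auto simp: iso_def)

lemma ti_hom: "ti \<in> hom A A" and si_hom: "si \<in> hom A A"
  using iso_set_sym[OF t_iso] iso_set_sym[OF s_iso] by (auto simp: iso_def ti_def si_def)

sublocale t: group_hom A A t by unfold_locales (rule t_hom)
sublocale s: group_hom A A s by unfold_locales (rule s_hom)
sublocale ti: group_hom A A ti by unfold_locales (rule ti_hom)
sublocale si: group_hom A A si by unfold_locales (rule si_hom)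

lemma inverses [simp]:
  assumes "x \<in> carrier A"
  shows "t (ti x) = x" "ti (t x) = x" "s (si x) = x" "si (s x) = x"
  using assms t_iso s_iso unfolding ti_def si_def iso_def bij_betw_def
  by (auto intro: f_inv_into_f)

lemma s_t: "x \<in> carrier A \<Longrightarrow> s (t x) = t (s x)"
  by (simp add: one_minus_def)

lemma si_t: "x \<in> carrier A \<Longrightarrow> si (t x) = t (si x)"
  by (metis inverses(3,4) s_t si.hom_closed t.hom_closed)

lemma si_ti: "x \<in> carrier A \<Longrightarrow> si (ti x) = ti (si x)"
  by (metis inverses(1,2) si_t si.hom_closed ti.hom_closed)

lemma t_mult_s: "x \<in> carrier A \<Longrightarrow> t x \<otimes> s x = x"
  by (simp add: one_minus_def m_lcomm[of "t x"])

lemma t_mult_s_mult: "\<lbrakk>x \<in> carrier A; y \<in> carrier A\<rbrakk> \<Longrightarrow> t x \<otimes> (y \<otimes> s x) = y \<otimes> x"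
  using t_mult_s[of x] by (simp add: m_lcomm[of "t x"])

end

section \<open>The homology relations force bilinearity and t-invariance\<close>

locale cocycle_mod = connected_alexander A t + difference_closed V
  for A :: "('a, 'b) monoid_scheme" (structure) and t and V :: "'h::ab_group_add set" +
  fixes e :: "'a \<Rightarrow> 'a \<Rightarrow> 'h"
  assumes diag: "x \<in> carrier A \<Longrightarrow> e x x \<in> V"
    and one_left: "y \<in> carrier A \<Longrightarrow> e \<one> y \<in> V"
    and cocycle: "\<lbrakk>x \<in> carrier A; y \<in> carrier A; z \<in> carrier A\<rbrakk> \<Longrightarrow>
      e x z - e (x \<triangleright> y) z - e x y + e (x \<triangleright> z) (y \<triangleright> z) \<in> V"
begin

text \<open>Since 0 * s^-1 x = x, the cocycle relation at (0, s^-1 x, 0) contains e(x, 0), and every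
  other term has first argument 0.\<close>

lemma one_right:
  assumes "x \<in> carrier A" shows "e x \<one> \<in> V"
proof -
  let ?y = "si x"
  have "e \<one> \<one> - e x \<one> - e \<one> ?y + e \<one> (t ?y) \<in> V"
    using cocycle[of \<one> ?y \<one>] assms by (simp add: alexander_op_def)
  from diff_mem[OF add_mem[OF diff_mem[OF one_left one_left] one_left] this, of \<one> ?y "t ?y"]
  show ?thesis using assms by simp
qed

text \<open>Acting by 0 is t, so the cocycle relation with third argument 0 compares e(x, y) with
  e(t x, t y); the other two terms vanish by \<open>one_right\<close>.\<close>

lemma t_invariant:
  assumes "x \<in> carrier A" "y \<in> carrier A"
  shows "e x y - e (t x) (t y) \<in> V"
proof -
  have "e x \<one> - e (x \<triangleright> y) \<one> - e x y + e (t x) (t y) \<in> V"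
    using cocycle[of x y \<one>] assms by (simp add: alexander_op_def)
  from diff_mem[OF diff_mem[OF one_right one_right] this, of x "x \<triangleright> y"]
  show ?thesis using assms by (simp add: alexander_op_def)
qed

text \<open>In the coordinates u = t x and v = s y the quandle product x * y is the plain sum u +
  v.\<close>

definition f where "f u v = e (ti u) (si v)"

lemma f_one: "u \<in> carrier A \<Longrightarrow> f \<one> u \<in> V"
  by (simp add: f_def one_left)

lemma f_t_invariant:
  assumes "u \<in> carrier A" "v \<in> carrier A"
  shows "f (ti u) (ti v) - f u v \<in> V"
  using t_invariant[of "ti (ti u)" "si (ti v)"] assms
  by (simp add: f_def si_t[symmetric])

text \<open>This is the cocycle relation at x = t^-2 a, y = t^-1 s^-1 b, z = s^-1 c. Its third term
  is f(t^-1 a, t^-1 b), which invariance turns into f(a, b).\<close>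

lemma f_relation:
  assumes "a \<in> carrier A" "b \<in> carrier A" "c \<in> carrier A"
  shows "f (ti a) c - f (a \<otimes> b) c - f a b + f (a \<otimes> t c) (b \<otimes> s c) \<in> V"
proof -
  have "f (ti a) c - f (a \<otimes> b) c - f (ti a) (ti b) + f (a \<otimes> t c) (b \<otimes> s c) \<in> V"
    using cocycle[of "ti (ti a)" "ti (si b)" "si c"] assms
    by (simp add: f_def alexander_op_def si_ti[symmetric] si_t[symmetric])
  from add_mem[OF this f_t_invariant[of a b]] show ?thesis
    using assms by (simp add: algebra_simps)
qed

lemma f_swap:
  assumes "b \<in> carrier A" "c \<in> carrier A"
  shows "f (t c) (b \<otimes> s c) - f b c \<in> V"
proof -
  have "f \<one> c - f b c - f \<one> b + f (t c) (b \<otimes> s c) \<in> V"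
    using f_relation[of \<one> b c] assms by simp
  from add_mem[OF diff_mem[OF this f_one[of c]] f_one[of b]] show ?thesis
    using assms by (simp add: algebra_simps)
qed

text \<open>
  Let \<open>\<tau>\<^sub>u\<close> act on pairs by \<open>(x, h) \<mapsto> (x + u, h + f(x, u))\<close>. The cocycle relation says that
  \<open>\<tau>\<^sub>c \<tau>\<^sub>y \<tau>\<^sub>c\<^sup>-\<^sup>1\<close> equals \<open>\<tau>\<close> at \<open>y + s c\<close> times the inverse of \<open>\<tau>\<close> at \<open>s c\<close>, which is the next lemma; conjugation
  by \<open>\<tau>\<^sub>c \<tau>\<^sub>b\<close> and by \<open>\<tau>\<close> at \<open>b + c\<close> therefore agree, and this yields the 2-cocycle identity.
\<close>

lemma f_conj:
  assumes "x \<in> carrier A" "y \<in> carrier A" "c \<in> carrier A"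
  shows "f x y + f (x \<otimes> y) c - f x c - f (x \<otimes> t c) (y \<otimes> s c) + f (x \<otimes> t c) (s c) \<in> V"
proof -
  have *: "f x \<one> \<in> V" using assms one_right by (simp add: f_def)
  have "f (ti x) c - f x c - f x \<one> + f (x \<otimes> t c) (s c) \<in> V"
    using f_relation[of x \<one> c] assms by simp
  from add_mem[OF diff_mem[OF this f_relation[OF assms]] *] show ?thesis
    by (simp add: algebra_simps)
qed

lemma f_group_cocycle:
  assumes "y \<in> carrier A" "b \<in> carrier A" "c \<in> carrier A"
  shows "f y b + f (y \<otimes> b) c - f b c - f y (b \<otimes> c) \<in> V"
proof -
  \<comment> \<open>The terms of the desired identity are rewritten by \<open>f_swap\<close> to have
    first argument t b or t(b + c), the shape that \<open>f_conj\<close> produces at x = t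
    b.\<close>
  have 1: "f (t b) (y \<otimes> s b) - f y b \<in> V" "f (t b) (s b) \<in> V"
    "f (t (b \<otimes> c)) (y \<otimes> s (b \<otimes> c)) - f y (b \<otimes> c) \<in> V"  "f (t (b \<otimes> c)) (s (b \<otimes> c)) \<in> V"
    using assms f_swap[of y b] f_swap[of y "b \<otimes> c"] diff_mem_trans[OF f_swap f_one, of b]
      diff_mem_trans[OF f_swap f_one, of "b \<otimes> c"]
    by (simp_all del: t.hom_mult s.hom_mult)
  have 2: "f (t b) (y \<otimes> s b) + f (y \<otimes> b) c - f (t b) c - f (t (b \<otimes> c)) (y \<otimes> s (b \<otimes> c))
      + f (t (b \<otimes> c)) (s c) \<in> V"
    using f_conj[of "t b" "y \<otimes> s b" c] assms by (simp add: t_mult_s_mult m_assoc)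
  \<comment> \<open>This is the preceding instance with y = 0; subtracting it cancels f(t b, c) and
    f(t(b + c), s c).\<close>
  have 3: "f (t b) (s b) + f b c - f (t b) c - f (t (b \<otimes> c)) (s (b \<otimes> c))
      + f (t (b \<otimes> c)) (s c) \<in> V"
    using f_conj[of "t b" "s b" c] assms by (simp add: t_mult_s)
  show ?thesis
    using add_mem[OF diff_mem[OF diff_mem[OF add_mem[OF diff_mem[OF 2 3] 1(2)] 1(1)] 1(4)] 1(3)]
    by (simp add: algebra_simps)
qed

text \<open>Because t u + s u = u, the 2-cocycle identity at (t u, s u, v) relates f(u, v) to f(s u,
  v). By \<open>f_swap\<close>, f(t u, s u) vanishes and f(t u, v + s u) becomes f(v, u).\<close>

lemma f_antisym:
  assumes "u \<in> carrier A" "v \<in> carrier A"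
  shows "f (s u) v - (f u v - f v u) \<in> V"
proof -
  have 1: "f (t u) (s u) \<in> V"
    using assms diff_mem_trans[OF f_swap f_one, of u] by auto
  have 2: "f (t u) (s u) + f u v - f (s u) v - f (t u) (v \<otimes> s u) \<in> V"
    using f_group_cocycle[of "t u" "s u" v] assms by (simp add: t_mult_s m_comm)
  from diff_mem[OF diff_mem[OF 1 2] f_swap[of v u]] show ?thesis
    using assms by (simp add: algebra_simps)
qed

text \<open>The expression f(u, v) - f(v, u) is the commutator pairing of the central extension
  given by f. Its additivity follows from the 2-cocycle identity at (a, b, c), (a, c, b) and (c, a,
  b), using that the group is abelian.\<close>

lemma f_commutator_mult:
  assumes "a \<in> carrier A" "b \<in> carrier A" "c \<in> carrier A"
  shows "(f (a \<otimes> b) c - f c (a \<otimes> b)) - (f a c - f c a) - (f b c - f c b) \<in> V"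
proof -
  have "f a b + f (a \<otimes> b) c - f b c - f a (b \<otimes> c) \<in> V"
    "f a c + f (a \<otimes> c) b - f c b - f a (b \<otimes> c) \<in> V"
    "f c a + f (a \<otimes> c) b - f a b - f c (a \<otimes> b) \<in> V"
    using f_group_cocycle[of a b c] f_group_cocycle[of a c b] f_group_cocycle[of c a b] assms
    by (simp_all add: m_comm)
  from add_mem[OF diff_mem[OF this(1,2)] this(3)] show ?thesis
    by (simp add: algebra_simps)
qed

text \<open>Writing a = s(s^-1 a) identifies f(a, c) with the commutator pairing of s^-1 a and c, by
  \<open>f_antisym\<close>; that pairing is additive.\<close>

lemma f_mult_left:
  assumes "a \<in> carrier A" "b \<in> carrier A" "c \<in> carrier A"
  shows "f (a \<otimes> b) c - f a c - f b c \<in> V"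
proof -
  have "f (a \<otimes> b) c - (f (si a \<otimes> si b) c - f c (si a \<otimes> si b)) \<in> V"
    "f a c - (f (si a) c - f c (si a)) \<in> V" "f b c - (f (si b) c - f c (si b)) \<in> V"
    using f_antisym[of "si a \<otimes> si b" c] f_antisym[of "si a" c] f_antisym[of "si b" c] assms
    by simp_all
  from add_mem[OF diff_mem[OF diff_mem[OF this(1,2)] this(3)] f_commutator_mult[of "si a" "si b" c]]
  show ?thesis using assms by (simp add: algebra_simps)
qed

lemma f_mult_right:
  assumes "a \<in> carrier A" "b \<in> carrier A" "c \<in> carrier A"
  shows "f c (a \<otimes> b) - f c a - f c b \<in> V"
  using diff_mem[OF f_mult_left[OF assms] f_commutator_mult[OF assms]]
  by (simp add: algebra_simps)

lemma e_eq: "\<lbrakk>x \<in> carrier A; y \<in> carrier A\<rbrakk> \<Longrightarrow> e x y = f (t x) (s y)"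
  by (simp add: f_def)

lemma mult_left:
  assumes "x \<in> carrier A" "y \<in> carrier A" "z \<in> carrier A"
  shows "e (x \<otimes> y) z - e x z - e y z \<in> V"
  using f_mult_left assms by (simp add: e_eq)

lemma mult_right:
  assumes "x \<in> carrier A" "y \<in> carrier A" "z \<in> carrier A"
  shows "e x (y \<otimes> z) - e x y - e x z \<in> V"
  using f_mult_right assms by (simp add: e_eq)

end

section \<open>Invariant alternating forms satisfy the homology relations\<close>

locale invariant_alternating_mod = connected_alexander A t + difference_closed V
  for A :: "('a, 'b) monoid_scheme" (structure) and t and V :: "'h::ab_group_add set" +
  fixes w :: "'a \<Rightarrow> 'a \<Rightarrow> 'h"
  assumes mult_left: "\<lbrakk>x \<in> carrier A; y \<in> carrier A; z \<in> carrier A\<rbrakk> \<Longrightarrow>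
      w (x \<otimes> y) z - w x z - w y z \<in> V"
    and mult_right: "\<lbrakk>x \<in> carrier A; y \<in> carrier A; z \<in> carrier A\<rbrakk> \<Longrightarrow>
      w x (y \<otimes> z) - w x y - w x z \<in> V"
    and diag: "x \<in> carrier A \<Longrightarrow> w x x \<in> V"
    and invariant: "\<lbrakk>x \<in> carrier A; y \<in> carrier A\<rbrakk> \<Longrightarrow> w x y - w (t x) (t y) \<in> V"
begin

lemma one_left:
  assumes "y \<in> carrier A" shows "w \<one> y \<in> V"
  using diff_mem[OF zero_mem mult_left[of \<one> \<one> y]] assms by simp

lemma antisym:
  assumes "x \<in> carrier A" "y \<in> carrier A" shows "w x y + w y x \<in> V"
proof -
  let ?xy = "x \<otimes> y"
  have "w ?xy ?xy - w x ?xy - w y ?xy \<in> V" "w x ?xy - w x x - w x y \<in> V"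
    "w y ?xy - w y x - w y y \<in> V"
    using assms by (simp_all add: mult_left mult_right)
  from diff_mem[OF diff_mem[OF diff_mem[OF diff_mem[OF diff_mem[OF diag this(1)] this(2)] this(3)] diag] diag,
      of ?xy x y]
  show ?thesis using assms by (simp add: algebra_simps)
qed

text \<open>Splitting x = t x + s x and then z = t z + s z writes w(x, z) - w(t x, t z) as this sum,
  and invariance kills the difference.\<close>

lemma s_balance:
  assumes "x \<in> carrier A" "z \<in> carrier A" shows "w (s x) z + w (t x) (s z) \<in> V"
proof -
  have "w x z - w (t x) z - w (s x) z \<in> V" "w (t x) z - w (t x) (t z) - w (t x) (s z) \<in> V"
    using mult_left[of "t x" "s x" z] mult_right[of "t x" "t z" "s z"] assms
    by (simp_all add: t_mult_s)
  from diff_mem[OF diff_mem[OF invariant[OF assms] this(1)] this(2)] show ?thesis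
    by (simp add: algebra_simps)
qed

lemma cocycle:
  assumes "x \<in> carrier A" "y \<in> carrier A" "z \<in> carrier A"
  shows "w x z - w (x \<triangleright> y) z - w x y + w (x \<triangleright> z) (y \<triangleright> z) \<in> V"
proof -
  let ?yz = "t y \<otimes> s z"
  have 1: "w x z - w (t x) z - w (s x) z \<in> V"
    using mult_left[of "t x" "s x" z] assms by (simp add: t_mult_s)
  have 2: "w (t x \<otimes> s y) z - w (t x) z - w (s y) z \<in> V"
    using mult_left assms by simp
  have 3: "w (t x \<otimes> s z) ?yz - w (t x) ?yz - w (s z) ?yz \<in> V"
    "w (t x) ?yz - w (t x) (t y) - w (t x) (s z) \<in> V"
    "w (s z) ?yz - w (s z) (t y) - w (s z) (s z) \<in> V"
    using mult_left mult_right assms by simp_all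
  have 4: "w (s x) z + w (t x) (s z) \<in> V" "w (s y) z + w (t y) (s z) \<in> V"
    "w (s z) (t y) + w (t y) (s z) \<in> V" "w (s z) (s z) \<in> V" "w x y - w (t x) (t y) \<in> V"
    using s_balance antisym diag invariant assms by simp_all
  \<comment> \<open>After bilinear expansion, w(s x, z) cancels against w(t x, s z), -w(s y, z)
    becomes w(t y, s z) and cancels against w(s z, t y), and w(x, y) cancels against w(t x, t y).
    The right-hand side records the members of \<open>V\<close> used.\<close>
  have "w x z - w (t x \<otimes> s y) z - w x y + w (t x \<otimes> s z) ?yz =
    (w x z - w (t x) z - w (s x) z) - (w (t x \<otimes> s y) z - w (t x) z - w (s y) z)
    + (w (t x \<otimes> s z) ?yz - w (t x) ?yz - w (s z) ?yz)
    + (w (t x) ?yz - w (t x) (t y) - w (t x) (s z))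
    + (w (s z) ?yz - w (s z) (t y) - w (s z) (s z))
    + (w (s x) z + w (t x) (s z)) - (w (s y) z + w (t y) (s z))
    + (w (s z) (t y) + w (t y) (s z)) + w (s z) (s z) - (w x y - w (t x) (t y))"
    by (simp add: algebra_simps)
  also have "\<dots> \<in> V"
    by (intro add_mem diff_mem 1 2 3 4)
  finally show ?thesis by (simp add: alexander_op_def)
qed

end

section \<open>Quotients by generated subgroups\<close>

lemma quot_class_eq: "quot_class G R = (\<lambda>x. generate G R #>\<^bsub>G\<^esub> x)"
  by (simp add: fun_eq_iff quot_class_def)

lemma carrier_quot_gen: "carrier (quot_gen G R) = quot_class G R ` carrier G"
  by (simp add: quot_gen_def quot_class_eq carrier_FactGroup)

context comm_group
begin

lemma generate_normal: "R \<subseteq> carrier G \<Longrightarrow> generate G R \<lhd> G"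
  by (simp add: generate_is_subgroup subgroup_imp_normal)

lemma comm_group_quot_gen: "R \<subseteq> carrier G \<Longrightarrow> comm_group (quot_gen G R)"
  by (simp add: quot_gen_def abelian_FactGroup generate_is_subgroup)

lemma quot_class_hom: "R \<subseteq> carrier G \<Longrightarrow> quot_class G R \<in> hom G (quot_gen G R)"
  by (simp add: quot_gen_def quot_class_eq normal.r_coset_hom_Mod generate_normal)

lemma quot_class_eq_one:
  assumes "R \<subseteq> carrier G" "r \<in> generate G R"
  shows "quot_class G R r = \<one>\<^bsub>quot_gen G R\<^esub>"
  using assms generate_in_carrier[OF assms]
  by (simp add: quot_gen_def quot_class_def coset_join2 generate_is_subgroup)

lemma quot_gen_lift:
  assumes "R \<subseteq> carrier G" "group H" "h \<in> hom G H" "\<And>r. r \<in> R \<Longrightarrow> h r = \<one>\<^bsub>H\<^esub>"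
  obtains g where "g \<in> hom (quot_gen G R) H"
    "\<And>x. x \<in> carrier G \<Longrightarrow> g (quot_class G R x) = h x"
proof -
  interpret h: group_hom G H h
    using assms by (simp add: group_hom_def group_hom_axioms_def)
  have "generate G R \<subseteq> kernel G H h"
    using assms by (intro generate_subgroup_incl h.subgroup_kernel) (auto simp: kernel_def)
  from h.FactGroup_universal_kernel[OF generate_normal[OF assms(1)] this] show ?thesis
    using that by (metis quot_gen_def quot_class_def)
qed

end

lemma hom_free_Abelian_group_diff:
  assumes "h \<in> hom (free_Abelian_group S) H" "group H"
    "Poly_Mapping.keys a \<subseteq> S" "Poly_Mapping.keys b \<subseteq> S"
  shows "h (a - b) = h a \<otimes>\<^bsub>H\<^esub> inv\<^bsub>H\<^esub> (h b)"
proof -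
  interpret h: group_hom "free_Abelian_group S" H h
    using assms by (simp add: group_hom_def group_hom_axioms_def)
  show ?thesis
    using h.hom_mult[of a "- b"] h.hom_inv[of b] assms by simp
qed

lemma keys_diff_subset:
  "\<lbrakk>Poly_Mapping.keys a \<subseteq> S; Poly_Mapping.keys b \<subseteq> S\<rbrakk> \<Longrightarrow> Poly_Mapping.keys (a - b) \<subseteq> S"
  using keys_diff[of a b] by blast

lemma difference_closed_hom_kernel:
  assumes "h \<in> hom (free_Abelian_group S) H" "group H"
  shows "difference_closed (kernel (free_Abelian_group S) H h)"
proof -
  interpret h: group_hom "free_Abelian_group S" H h
    using assms by (simp add: group_hom_def group_hom_axioms_def)
  show ?thesis
    by standard
      (use h.hom_one in \<open>auto simp: kernel_def keys_diff_subset hom_free_Abelian_group_diff[OF assms]\<close>)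
qed

section \<open>The coinvariants of the exterior square\<close>

context connected_alexander
begin

abbreviation "Q \<equiv> carrier A"
abbreviation "F \<equiv> free_Abelian_group (Q \<times> Q)"
abbreviation "T \<equiv> tensor_square A"
abbreviation "E \<equiv> exterior_square A"
abbreviation "W \<equiv> wedge_coinvariants A t"
abbreviation "Z2 \<equiv> rack_Z2 Q (\<triangleright>)"
abbreviation "H2 \<equiv> quandle_H2 Q (\<triangleright>)"
abbreviation "cycle_rels \<equiv> rack_d3 (\<triangleright>) ` carrier (rack_C3 Q) \<union> (\<lambda>a. frag_of (a, a)) ` Q"
abbreviation "alt_rels \<equiv> {tensor A x x | x. x \<in> Q}"
abbreviation "inv_rels \<equiv> {wedge A x y \<otimes>\<^bsub>E\<^esub> inv\<^bsub>E\<^esub> (wedge A (t x) (t y)) | x y. x \<in> Q \<and> y \<in> Q}"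

sublocale alex: quandle Q "(\<triangleright>)" by (rule alexander_quandle[OF t_iso])

sublocale F: comm_group F by (rule abelian_free_Abelian_group)

lemma tensor_rels_subset: "tensor_rels A \<subseteq> carrier F"
  by (auto simp: tensor_rels_def keys_diff_subset intro!: keys_diff_subset)

sublocale T: comm_group T
  unfolding tensor_square_def by (rule F.comm_group_quot_gen[OF tensor_rels_subset])

definition qT where "qT = quot_class F (tensor_rels A)"

lemma qT_hom: "qT \<in> hom F T"
  unfolding tensor_square_def qT_def by (rule F.quot_class_hom[OF tensor_rels_subset])

lemma tensor_eq: "tensor A x y = qT (frag_of (x, y))"
  by (simp add: tensor_def qT_def)

lemma alt_rels_subset: "alt_rels \<subseteq> carrier T"
  by (auto simp: tensor_eq intro!: hom_in_carrier[OF qT_hom])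

sublocale E: comm_group E
  unfolding exterior_square_def by (rule T.comm_group_quot_gen[OF alt_rels_subset])

definition qE where "qE = quot_class T alt_rels"

lemma qE_hom: "qE \<in> hom T E"
  unfolding exterior_square_def qE_def by (rule T.quot_class_hom[OF alt_rels_subset])

lemma wedge_eq: "wedge A x y = qE (qT (frag_of (x, y)))"
  by (simp add: wedge_def qE_def tensor_eq)

lemma qE_qT_hom: "(\<lambda>c. qE (qT c)) \<in> hom F E"
  using Group.hom_compose[OF qT_hom qE_hom] by (simp add: o_def)

text \<open>Pulling the relators of the last quotient back to formal sums lets all three stages be
  treated uniformly in \<open>F\<close>.\<close>

lemma inv_rel_eq:
  assumes "x \<in> Q" "y \<in> Q"
  shows "wedge A x y \<otimes>\<^bsub>E\<^esub> inv\<^bsub>E\<^esub> (wedge A (t x) (t y)) =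
    qE (qT (frag_of (x, y) - frag_of (t x, t y)))"
  using hom_free_Abelian_group_diff[OF qE_qT_hom E.is_group, of "frag_of (x, y)" "frag_of (t x, t y)"]
    assms by (simp add: wedge_eq)

lemma inv_rels_subset: "inv_rels \<subseteq> carrier E"
  by (auto simp: inv_rel_eq keys_diff_subset intro!: hom_in_carrier[OF qE_qT_hom])

sublocale W: comm_group W
  unfolding wedge_coinvariants_def by (rule E.comm_group_quot_gen[OF inv_rels_subset])

definition qW where "qW = quot_class E inv_rels"

lemma qW_hom: "qW \<in> hom E W"
  unfolding wedge_coinvariants_def qW_def by (rule E.quot_class_hom[OF inv_rels_subset])

definition wedge_class where "wedge_class c = qW (qE (qT c))"

lemma wedge_class_hom: "wedge_class \<in> hom F W"
  using Group.hom_compose[OF qE_qT_hom qW_hom] by (simp add: o_def wedge_class_def[abs_def])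

lemma carrier_W: "carrier W = wedge_class ` carrier F"
  unfolding wedge_coinvariants_def exterior_square_def tensor_square_def wedge_class_def
    carrier_quot_gen qW_def qE_def qT_def
  by (simp add: image_image)

sublocale wedge: invariant_alternating_mod A t "kernel F W wedge_class" "\<lambda>x y. frag_of (x, y)"
proof -
  interpret V: difference_closed "kernel F W wedge_class"
    by (rule difference_closed_hom_kernel[OF wedge_class_hom W.is_group])
  have qT1: "qT c = \<one>\<^bsub>T\<^esub>" if "c \<in> tensor_rels A" for c
    unfolding qT_def tensor_square_def
    by (rule F.quot_class_eq_one[OF tensor_rels_subset generate.incl[OF that]])
  have qE1: "qE c = \<one>\<^bsub>E\<^esub>" if "c \<in> alt_rels" for c
    unfolding qE_def exterior_square_def
    by (rule T.quot_class_eq_one[OF alt_rels_subset generate.incl[OF that]])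
  have qW1: "qW c = \<one>\<^bsub>W\<^esub>" if "c \<in> inv_rels" for c
    unfolding qW_def wedge_coinvariants_def
    by (rule E.quot_class_eq_one[OF inv_rels_subset generate.incl[OF that]])
  \<comment> \<open>A relator killed at an early stage stays trivial under the later
    projections.\<close>
  have one: "qE \<one>\<^bsub>T\<^esub> = \<one>\<^bsub>E\<^esub>" "qW \<one>\<^bsub>E\<^esub> = \<one>\<^bsub>W\<^esub>"
    by (simp_all add: hom_one[OF qE_hom] hom_one[OF qW_hom])
  have T: "c \<in> kernel F W wedge_class" if "c \<in> tensor_rels A" for c
    using subsetD[OF tensor_rels_subset that] qT1[OF that]
    by (simp add: kernel_def wedge_class_def one)
  show "invariant_alternating_mod A t (kernel F W wedge_class) (\<lambda>x y. frag_of (x, y))"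
  proof
    fix x y z assume "x \<in> Q" "y \<in> Q" "z \<in> Q"
    then have "frag_of (x \<otimes> y, z) - frag_of (x, z) - frag_of (y, z) \<in> tensor_rels A"
      "frag_of (x, y \<otimes> z) - frag_of (x, y) - frag_of (x, z) \<in> tensor_rels A"
      unfolding tensor_rels_def by blast+
    then show "frag_of (x \<otimes> y, z) - frag_of (x, z) - frag_of (y, z) \<in> kernel F W wedge_class"
      "frag_of (x, y \<otimes> z) - frag_of (x, y) - frag_of (x, z) \<in> kernel F W wedge_class"
      using T by blast+
  next
    fix x assume "x \<in> Q"
    moreover from this have "qE (qT (frag_of (x, x))) = \<one>\<^bsub>E\<^esub>"
      by (intro qE1) (auto simp: tensor_eq)
    ultimately show "frag_of (x, x) \<in> kernel F W wedge_class"
      by (simp add: kernel_def wedge_class_def one)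
  next
    fix x y assume xy: "x \<in> Q" "y \<in> Q"
    then have "qE (qT (frag_of (x, y) - frag_of (t x, t y))) \<in> inv_rels"
      using inv_rel_eq[OF xy, symmetric] by blast
    from qW1[OF this] have "qW (qE (qT (frag_of (x, y) - frag_of (t x, t y)))) = \<one>\<^bsub>W\<^esub>" .
    then show "frag_of (x, y) - frag_of (t x, t y) \<in> kernel F W wedge_class"
      using xy by (simp add: kernel_def wedge_class_def keys_diff_subset)
  qed
qed

text \<open>Universal property of the threefold quotient, phrased on formal sums: each stage factors
  the map obtained from the one before.\<close>

lemma W_lift:
  assumes "group H" "h \<in> hom F H"
    and "\<And>x y z. \<lbrakk>x \<in> Q; y \<in> Q; z \<in> Q\<rbrakk> \<Longrightarrow>
      h (frag_of (x \<otimes> y, z) - frag_of (x, z) - frag_of (y, z)) = \<one>\<^bsub>H\<^esub>"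
    and "\<And>x y z. \<lbrakk>x \<in> Q; y \<in> Q; z \<in> Q\<rbrakk> \<Longrightarrow>
      h (frag_of (x, y \<otimes> z) - frag_of (x, y) - frag_of (x, z)) = \<one>\<^bsub>H\<^esub>"
    and "\<And>x. x \<in> Q \<Longrightarrow> h (frag_of (x, x)) = \<one>\<^bsub>H\<^esub>"
    and "\<And>x y. \<lbrakk>x \<in> Q; y \<in> Q\<rbrakk> \<Longrightarrow> h (frag_of (x, y) - frag_of (t x, t y)) = \<one>\<^bsub>H\<^esub>"
  obtains g where "g \<in> hom W H" "\<And>c. c \<in> carrier F \<Longrightarrow> g (wedge_class c) = h c"
proof -
  have "h r = \<one>\<^bsub>H\<^esub>" if "r \<in> tensor_rels A" for r
    using that assms(3,4) unfolding tensor_rels_def by blast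
  from F.quot_gen_lift[OF tensor_rels_subset assms(1,2) this,
      folded tensor_square_def qT_def]
  obtain h1 where h1: "h1 \<in> hom T H" "\<And>c. c \<in> carrier F \<Longrightarrow> h1 (qT c) = h c"
    by blast
  have "h1 (tensor A x x) = \<one>\<^bsub>H\<^esub>" if "x \<in> Q" for x
    using h1(2)[of "frag_of (x, x)"] assms(5)[OF that] that by (simp add: tensor_eq)
  then have "h1 r = \<one>\<^bsub>H\<^esub>" if "r \<in> alt_rels" for r
    using that by blast
  from T.quot_gen_lift[OF alt_rels_subset assms(1) h1(1) this,
      folded exterior_square_def qE_def]
  obtain h2 where h2: "h2 \<in> hom E H" "\<And>c. c \<in> carrier T \<Longrightarrow> h2 (qE c) = h1 c"
    by blast
  have h2': "h2 (qE (qT c)) = h c" if "c \<in> carrier F" for c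
    by (simp only: h2(2)[OF hom_in_carrier[OF qT_hom that]] h1(2)[OF that])
  have "h2 (qE (qT (frag_of (x, y) - frag_of (t x, t y)))) = \<one>\<^bsub>H\<^esub>" if "x \<in> Q" "y \<in> Q" for x y
    using h2'[of "frag_of (x, y) - frag_of (t x, t y)"] assms(6)[OF that] that
    by (simp add: keys_diff_subset)
  then have "h2 r = \<one>\<^bsub>H\<^esub>" if "r \<in> inv_rels" for r
    using that inv_rel_eq by force
  from E.quot_gen_lift[OF inv_rels_subset assms(1) h2(1) this,
      folded wedge_coinvariants_def qW_def]
  obtain h3 where h3: "h3 \<in> hom W H" "\<And>c. c \<in> carrier E \<Longrightarrow> h3 (qW c) = h2 c"
    by blast
  have "h3 (wedge_class c) = h c" if "c \<in> carrier F" for c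
    unfolding wedge_class_def
    by (simp only: h3(2)[OF hom_in_carrier[OF qE_qT_hom that]] h2'[OF that])
  with h3(1) that show ?thesis by blast
qed

section \<open>Projection onto cycles and the second homology\<close>

abbreviation d2 where "d2 \<equiv> rack_d2 (\<triangleright>)"

lemma d2_hom: "d2 \<in> hom F (free_Abelian_group Q)"
proof (rule homI)
  fix c assume "c \<in> carrier F"
  then have "Poly_Mapping.keys c \<subseteq> Q \<times> Q" by simp
  then show "d2 c \<in> carrier (free_Abelian_group Q)"
  proof (induction c rule: frag_induction)
    case (one p)
    then show ?case
      by (cases p) (simp add: rack_d2_def keys_diff_subset alex.star_closed)
  qed (simp_all add: rack_d2_def frag_extend_diff keys_diff_subset)
qed (simp add: rack_d2_def frag_extend_add)

lemma Z2_subgroup: "subgroup (kernel F (free_Abelian_group Q) d2) F"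
  by (intro group_hom.subgroup_kernel) (simp add: group_hom_def group_hom_axioms_def d2_hom)

lemma carrier_Z2: "carrier Z2 = {c \<in> carrier F. d2 c = 0}"
proof -
  have "carrier Z2 = kernel F (free_Abelian_group Q) d2"
    unfolding rack_Z2_def rack_C2_def rack_C1_def
    by (rule subgroup.carrier_subgroup_generated_subgroup[OF Z2_subgroup])
  then show ?thesis by (simp add: kernel_def)
qed

lemma mult_Z2 [simp]: "a \<otimes>\<^bsub>Z2\<^esub> b = a + b"
  by (simp add: rack_Z2_def rack_C2_def)

lemma one_Z2 [simp]: "\<one>\<^bsub>Z2\<^esub> = 0"
  by (simp add: rack_Z2_def rack_C2_def)

sublocale Z2: comm_group Z2
  unfolding rack_Z2_def rack_C2_def by (rule F.abelian_subgroup_generated[OF F.comm_group_axioms])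

lemma inv_Z2: "c \<in> carrier Z2 \<Longrightarrow> inv\<^bsub>Z2\<^esub> c = - c"
  by (rule Z2.inv_equality) (auto simp: carrier_Z2 rack_d2_def frag_extend_minus)

lemma cycle_rels_subset: "cycle_rels \<subseteq> carrier Z2"
  by (rule alex.quandle_H2_relators_are_cycles)

sublocale H2: comm_group H2
  unfolding quandle_H2_def by (rule Z2.comm_group_quot_gen[OF cycle_rels_subset])

definition hclass where "hclass = quot_class Z2 cycle_rels"

lemma hclass_hom: "hclass \<in> hom Z2 H2"
  unfolding quandle_H2_def hclass_def by (rule Z2.quot_class_hom[OF cycle_rels_subset])

lemma hclass_eq_one: "c \<in> generate Z2 cycle_rels \<Longrightarrow> hclass c = \<one>\<^bsub>H2\<^esub>"
  unfolding quandle_H2_def hclass_def by (rule Z2.quot_class_eq_one[OF cycle_rels_subset])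

definition cone where "cone = frag_extend (\<lambda>x. frag_of (\<one>, si x))"

lemma cone_closed: "Poly_Mapping.keys c \<subseteq> Q \<Longrightarrow> Poly_Mapping.keys (cone c) \<subseteq> Q \<times> Q"
  by (induction c rule: frag_induction) (simp_all add: cone_def frag_extend_diff keys_diff_subset)

definition cycle_proj where "cycle_proj c = c + cone (d2 c)"

lemma cycle_proj_diff: "cycle_proj (a - b) = cycle_proj a - cycle_proj b"
  by (simp add: cycle_proj_def cone_def rack_d2_def frag_extend_diff)

lemma cycle_proj_add: "cycle_proj (a + b) = cycle_proj a + cycle_proj b"
  by (simp add: cycle_proj_def cone_def rack_d2_def frag_extend_add)

lemma cycle_proj_cycle: "c \<in> carrier Z2 \<Longrightarrow> cycle_proj c = c"
  by (simp add: cycle_proj_def cone_def carrier_Z2)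

text \<open>The boundary (x) - (x * y) has coefficient sum 0, so in the boundary of its cone the two
  terms (0) cancel and only its negative remains.\<close>

lemma cycle_proj_closed:
  assumes "c \<in> carrier F" shows "cycle_proj c \<in> carrier Z2"
proof -
  have "Poly_Mapping.keys c \<subseteq> Q \<times> Q" using assms by simp
  then show ?thesis
  proof (induction c rule: frag_induction)
    case zero
    then show ?case by (simp add: cycle_proj_def cone_def rack_d2_def carrier_Z2)
  next
    case (one p)
    obtain x y where p: "p = (x, y)" and xy: "x \<in> Q" "y \<in> Q" using one by auto
    have "cycle_proj (frag_of p) = frag_of (x, y) - (frag_of (\<one>, si (x \<triangleright> y)) - frag_of (\<one>, si x))"
      by (simp add: p cycle_proj_def cone_def rack_d2_def frag_extend_diff)
    moreover have "\<one> \<triangleright> si u = u" if "u \<in> Q" for u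
      using that by (simp add: alexander_op_def)
    ultimately show ?case
      using xy by (simp add: carrier_Z2 keys_diff_subset rack_d2_def frag_extend_diff alex.star_closed)
  next
    case (diff a b)
    then show ?case
      by (simp add: cycle_proj_diff carrier_Z2 keys_diff_subset rack_d2_def frag_extend_diff)
  qed
qed

lemma cycle_proj_hom: "cycle_proj \<in> hom F Z2"
  by (rule homI) (simp_all add: cycle_proj_closed cycle_proj_add)

text \<open>Membership in this \<open>V\<close> means trivial homology class, so the bilinearity
  derived abstractly becomes a statement about classes of projected symbols.\<close>

sublocale H: cocycle_mod A t "generate Z2 cycle_rels" "\<lambda>x y. cycle_proj (frag_of (x, y))"
proof
  have sub: "subgroup (generate Z2 cycle_rels) Z2"
    by (rule Z2.generate_is_subgroup[OF cycle_rels_subset])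
  show "0 \<in> generate Z2 cycle_rels"
    using subgroup.one_closed[OF sub] by simp
  show "a - b \<in> generate Z2 cycle_rels"
    if "a \<in> generate Z2 cycle_rels" "b \<in> generate Z2 cycle_rels" for a b
    using subgroup.m_closed[OF sub that(1) subgroup.m_inv_closed[OF sub that(2)]]
      inv_Z2[OF subgroup.mem_carrier[OF sub that(2)]] by simp
  have rel: "cycle_proj c \<in> generate Z2 cycle_rels" if "c \<in> cycle_rels" for c
    using cycle_proj_cycle[OF subsetD[OF cycle_rels_subset that]] generate.incl[OF that] by simp
  show "cycle_proj (frag_of (x, x)) \<in> generate Z2 cycle_rels" if "x \<in> Q" for x
    using that by (intro rel) auto
  show "cycle_proj (frag_of (\<one>, y)) \<in> generate Z2 cycle_rels" if "y \<in> Q" for y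
  proof -
    \<comment> \<open>The boundary (0) - (s y) has cone (0, 0) - (0, y), which leaves a diagonal
      relator.\<close>
    have "cycle_proj (frag_of (\<one>, y)) = frag_of (\<one>, \<one>)"
      using that by (simp add: cycle_proj_def cone_def rack_d2_def frag_extend_diff alexander_op_def)
    then show ?thesis by (auto intro: generate.incl)
  qed
  show "cycle_proj (frag_of (x, z)) - cycle_proj (frag_of (x \<triangleright> y, z)) - cycle_proj (frag_of (x, y))
      + cycle_proj (frag_of (x \<triangleright> z, y \<triangleright> z)) \<in> generate Z2 cycle_rels"
    if "x \<in> Q" "y \<in> Q" "z \<in> Q" for x y z
  proof -
    have "rack_d3 (\<triangleright>) (frag_of (x, y, z)) \<in> cycle_rels"
      using that by (auto simp: rack_C3_def)
    from rel[OF this] show ?thesis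
      by (simp add: rack_d3_def cycle_proj_diff cycle_proj_add)
  qed
qed

section \<open>The mutually inverse homomorphisms\<close>

lemma wedge_class_cone:
  assumes "Poly_Mapping.keys c \<subseteq> Q" shows "cone c \<in> kernel F W wedge_class"
  using assms
proof (induction c rule: frag_induction)
  case zero
  then show ?case using wedge.zero_mem by (simp add: cone_def)
next
  case (one x)
  then show ?case using wedge.one_left[of "si x"] by (simp add: cone_def)
next
  case (diff a b)
  then show ?case using wedge.diff_mem by (simp add: cone_def frag_extend_diff)
qed

text \<open>The correction added by the projection consists of symbols (0, y), and 0 wedge y is
  trivial.\<close>

lemma wedge_class_cycle_proj:
  assumes "c \<in> carrier F" shows "wedge_class (cycle_proj c) = wedge_class c"
proof -
  have "cone (d2 c) \<in> kernel F W wedge_class"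
    using hom_in_carrier[OF d2_hom assms] by (intro wedge_class_cone) simp
  then have "cone (d2 c) \<in> carrier F" "wedge_class (cone (d2 c)) = \<one>\<^bsub>W\<^esub>"
    by (simp_all add: kernel_def)
  then show ?thesis
    using hom_mult[OF wedge_class_hom assms, of "cone (d2 c)"] hom_in_carrier[OF wedge_class_hom assms]
    by (simp add: cycle_proj_def)
qed

lemma wedge_class_cycle_rel:
  assumes "c \<in> cycle_rels" shows "wedge_class c = \<one>\<^bsub>W\<^esub>"
proof -
  have "rack_d3 (\<triangleright>) c \<in> kernel F W wedge_class" if "Poly_Mapping.keys c \<subseteq> Q \<times> Q \<times> Q" for c
    using that
  proof (induction c rule: frag_induction)
    case zero
    then show ?case using wedge.zero_mem by (simp add: rack_d3_def)
  next
    case (one p)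
    then show ?case using wedge.cocycle by (cases p) (simp add: rack_d3_def)
  next
    case (diff a b)
    then show ?case using wedge.diff_mem by (simp add: rack_d3_def frag_extend_diff)
  qed
  then have "rack_d3 (\<triangleright>) ` carrier (rack_C3 Q) \<subseteq> kernel F W wedge_class"
    by (auto simp: rack_C3_def)
  then have "c \<in> kernel F W wedge_class"
    using assms wedge.diag by blast
  then show ?thesis
    by (simp add: kernel_def)
qed

theorem H2_iso_W: "H2 \<cong> W"
proof -
  have hom: "(\<lambda>c. hclass (cycle_proj c)) \<in> hom F H2"
    using Group.hom_compose[OF cycle_proj_hom hclass_hom] by (simp add: o_def)
  obtain g where g: "g \<in> hom W H2"
    "\<And>c. c \<in> carrier F \<Longrightarrow> g (wedge_class c) = hclass (cycle_proj c)"
  proof (rule W_lift[OF H2.is_group hom])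
    fix x y z assume xyz: "x \<in> Q" "y \<in> Q" "z \<in> Q"
    show "hclass (cycle_proj (frag_of (x \<otimes> y, z) - frag_of (x, z) - frag_of (y, z))) = \<one>\<^bsub>H2\<^esub>"
      unfolding cycle_proj_diff by (rule hclass_eq_one[OF H.mult_left[OF xyz]])
    show "hclass (cycle_proj (frag_of (x, y \<otimes> z) - frag_of (x, y) - frag_of (x, z))) = \<one>\<^bsub>H2\<^esub>"
      unfolding cycle_proj_diff by (rule hclass_eq_one[OF H.mult_right[OF xyz]])
  next
    fix x assume "x \<in> Q"
    then show "hclass (cycle_proj (frag_of (x, x))) = \<one>\<^bsub>H2\<^esub>"
      by (rule hclass_eq_one[OF H.diag])
  next
    fix x y assume xy: "x \<in> Q" "y \<in> Q"
    show "hclass (cycle_proj (frag_of (x, y) - frag_of (t x, t y))) = \<one>\<^bsub>H2\<^esub>"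
      unfolding cycle_proj_diff by (rule hclass_eq_one[OF H.t_invariant[OF xy]])
  qed blast
  have "wedge_class \<in> hom Z2 W"
    using wedge_class_hom by (auto simp: hom_def carrier_Z2 Pi_def)
  from Z2.quot_gen_lift[OF cycle_rels_subset W.is_group this wedge_class_cycle_rel,
      folded quandle_H2_def hclass_def]
  obtain f where f: "f \<in> hom H2 W" "\<And>c. c \<in> carrier Z2 \<Longrightarrow> f (hclass c) = wedge_class c"
    by blast
  have "carrier H2 = hclass ` carrier Z2"
    by (simp add: quandle_H2_def hclass_def carrier_quot_gen)
  \<comment> \<open>One composite is the identity because the projection fixes cycles, the other
    because \<open>wedge_class\<close> does not see the correction; both carriers consist of such
    classes.\<close>
  moreover have "g (f (hclass c)) = hclass c" if "c \<in> carrier Z2" for c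
    using that by (simp add: f g cycle_proj_cycle carrier_Z2)
  moreover have "f (g (wedge_class c)) = wedge_class c" if "c \<in> carrier F" for c
    using that cycle_proj_closed[OF that] by (simp add: f g wedge_class_cycle_proj)
  ultimately have "group_isomorphisms H2 W f g"
    unfolding group_isomorphisms_def using f(1) g(1) by (simp add: carrier_W)
  then show ?thesis
    by (rule is_isoI[OF group_isomorphisms_imp_iso])
qed

end

theorem corollary4p3:
  fixes A :: "('a, 'b) monoid_scheme" and t :: "'a \<Rightarrow> 'a"
  assumes "comm_group A"
    and "t \<in> iso A A"
    and "one_minus A t \<in> iso A A"
  shows "quandle_H2 (carrier A) (alexander_op A t) \<cong> wedge_coinvariants A t"
proof -
  interpret connected_alexander A t
    using assms by (simp add: connected_alexander_def connected_alexander_axioms_def)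
  show ?thesis by (rule H2_iso_W)
qed

end
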